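(* Let $N>1$, $\alpha\in(0,1)$, $r_0^{\min}\in\mathbb{R}$, and let $f:\mathbb{R}\to\mathbb{R}$ be differentiable. With $\mathcal{R}_0$, $\mathbb{P}_N$ and $g_\alpha$ as defined in the context, let $r_0^{*,\max}\in\mathbb{R}$ be a (local) optimal solution of $$\min_{r_0^{\max}\in\mathcal{R}_0} f(r_0^{\max})\quad\text{s.t.}\quad\mathbb{P}_N\left(b\in M(t,r_0^{\max})\ \forall t\in[0,T]\right)\ge\alpha.$$ Then there exists a multiplier $\mu^*\ge0$ such that $$f'(r_0^{*,\max})+\mu^*\,g_\alpha'(r_0^{*,\max})=0,\qquad g_\alpha(r_0^{*,\max})\le0,\qquad\mu^*\,g_\alpha(r_0^{*,\max})=0,$$ i.e. $(r_0^{*,\max},\mu^* )\in\mathbb{R}^2$ is a Karush-Kuhn-Tucker point.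
   Context: **Samples.** Consider a linear graph with nodes $v_0,\dots,v_n$ and edges $e_1,\dots,e_n$, $e_k$ joining $v_{k-1}$ to $v_k$ and having length $L_k>0$; constants $d_k<0$, $m_k\le0$; initial states $r_{k,0}$; and the system (for $k=1,\dots,n$, $(t,x)\in[0,T]\times[0,L_k]$) $$(r_k)_t+d_k(r_k)_x=m_kr_k,\qquad r_k(0,x)=r_{k,0}(x),\qquad r_k(t,L_k)=\begin{cases}b_n(t)&k=n,\\ r_{k+1}(t,0)+b_k(t)&k<n.\end{cases}$$ Let $b^{\mathcal{S},1},\dots,b^{\mathcal{S},N}$ be fixed sample boundary functions $[0,T]\to\mathbb{R}^n_{\ge0}$, and let $r_1(t,0,b^{\mathcal{S},i})$ be the value at node $v_0$ (i.e. $x=0$ on edge $e_1$) of the solution with boundary data $b^{\mathcal{S},i}$, assumed such that the following extrema exist: $$\underline r^{S,i}:=\min_{t\in[0,T]}r_1(t,0,b^{\mathcal{S},i}),\qquad\overline r^{S,i}:=\max_{t\in[0,T]}r_1(t,0,b^{\mathcal{S},i}).$$ The set $M(t,r_0^{\max})$ consists of the nonnegative boundary functions $b$ for which $r_1(t,0)\in[r_0^{\min},r_0^{\max}]$. **Approximated probability and constraint.** Let $(\sigma^{\min})^2$ and $(\sigma^{\max})^2$ be the (assumed positive) sample variances, normalized by $1/(N-1)$, of $(\underline r^{S,i})_{i=1}^N$ and $(\overline r^{S,i})_{i=1}^N$, and let $h_y=\left(\frac{4}{(2+2)N}\right)^{1/(2+4)}=N^{-1/6}$. Put $$\varphi_i^{\min}(x)=\frac{x-\underline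 r^{S,i}}{\sqrt2\,h_y\sigma^{\min}},\qquad\varphi_i^{\max}(x)=\frac{x-\overline r^{S,i}}{\sqrt2\,h_y\sigma^{\max}},\qquad\operatorname{erf}(x)=\frac{2}{\sqrt\pi}\int_0^xe^{-t^2}dt.$$ Integrating the two-dimensional Gaussian product kernel density estimator of (minimum, maximum) over $[r_0^{\min},r_0^{\max}]^2$ gives the definition $$\mathbb{P}_N\left(b\in M(t,r_0^{\max})\ \forall t\in[0,T]\right):=\frac{1}{4N}\sum_{i=1}^N\left[\operatorname{erf}(\varphi_i^{\min}(r_0^{\max}))-\operatorname{erf}(\varphi_i^{\min}(r_0^{\min}))\right]\cdot\left[\operatorname{erf}(\varphi_i^{\max}(r_0^{\max}))-\operatorname{erf}(\varphi_i^{\max}(r_0^{\min}))\right].$$ Let $\mathcal{R}_0=[r_0^{\min},\infty)$ and $g_\alpha:\mathbb{R}\to\mathbb{R}$, $g_\alpha(r_0^{\max})=\alpha-\mathbb{P}_N\left(b\in M(t,r_0^{\max})\ \forall t\in[0,T]\right)$. *)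

theory Defs
  imports "HOL-Analysis.Analysis"
begin

(* The transport equation r_t + d r_x = m r on [0,T] x [0,L], where r_t + d r_x is the derivative of
   r in the direction (1, d), taken within the rectangle.  A classical solution satisfies this
   (transport_solution_classical); in addition, kinks and jumps that are transported along
   characteristics are allowed, as they arise for boundary data that are not smooth. *)
definition transport_solution ::
  "real \<Rightarrow> real \<Rightarrow> real \<Rightarrow> real \<Rightarrow> (real \<Rightarrow> real \<Rightarrow> real) \<Rightarrow> bool" where
  "transport_solution T L d m r \<longleftrightarrow>
     (\<forall>t\<in>{0..T}. \<forall>x\<in>{0..L}.
        ((\<lambda>s. r (t + s) (x + d * s)) has_real_derivative m * r t x)
          (at 0 within {s. t + s \<in> {0..T} \<and> x + d * s \<in> {0..L}}))"

(* r k t x is the state on edge e_k, for k = 1, ..., n. *)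
definition network_solution ::
  "nat \<Rightarrow> real \<Rightarrow> (nat \<Rightarrow> real) \<Rightarrow> (nat \<Rightarrow> real) \<Rightarrow> (nat \<Rightarrow> real) \<Rightarrow> (nat \<Rightarrow> real \<Rightarrow> real) \<Rightarrow>
   (nat \<Rightarrow> real \<Rightarrow> real) \<Rightarrow> (nat \<Rightarrow> real \<Rightarrow> real \<Rightarrow> real) \<Rightarrow> bool" where
  "network_solution n T L d m r0 b r \<longleftrightarrow>
     (\<forall>k\<in>{1..n}.
        transport_solution T (L k) (d k) (m k) (r k) \<and>
        (\<forall>x\<in>{0..L k}. r k 0 x = r0 k x) \<and>
        (\<forall>t\<in>{0..T}. r k t (L k) = (if k = n then b n t else r (k + 1) t 0 + b k t)))"

definition node_value :: "(nat \<Rightarrow> real \<Rightarrow> real \<Rightarrow> real) \<Rightarrow> real \<Rightarrow> real" where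
  "node_value r t = r 1 t 0"

(* On a set of reals, LEAST and GREATEST denote the minimum and the maximum, if attained. *)
definition node_min :: "real \<Rightarrow> (nat \<Rightarrow> real \<Rightarrow> real \<Rightarrow> real) \<Rightarrow> real" where
  "node_min T r = (LEAST y. y \<in> node_value r ` {0..T})"

definition node_max :: "real \<Rightarrow> (nat \<Rightarrow> real \<Rightarrow> real \<Rightarrow> real) \<Rightarrow> real" where
  "node_max T r = (GREATEST y. y \<in> node_value r ` {0..T})"

definition sample_mean :: "nat \<Rightarrow> (nat \<Rightarrow> real) \<Rightarrow> real" where
  "sample_mean N y = (\<Sum>i=1..N. y i) / real N"

definition sample_variance :: "nat \<Rightarrow> (nat \<Rightarrow> real) \<Rightarrow> real" where
  "sample_variance N y = (\<Sum>i=1..N. (y i - sample_mean N y)\<^sup>2) / (real N - 1)"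

definition bandwidth :: "nat \<Rightarrow> real" where
  "bandwidth N = (4 / ((2 + 2) * real N)) powr (1 / (2 + 4))"

(* The interval integral is oriented, so this is the error function for negative x as well. *)
definition erf :: "real \<Rightarrow> real" where
  "erf x = 2 / sqrt pi * (LBINT t=0..x. exp (- t\<^sup>2))"

definition phi :: "nat \<Rightarrow> (nat \<Rightarrow> real) \<Rightarrow> nat \<Rightarrow> real \<Rightarrow> real" where
  "phi N y i x = (x - y i) / (sqrt 2 * bandwidth N * sqrt (sample_variance N y))"

(* The Gaussian product kernel density estimator of (minimum, maximum) integrated over the square
   [lo, hi] x [lo, hi]; r i is the solution for the i-th sample, i = 1, ..., N. *)
definition approx_prob ::
  "nat \<Rightarrow> real \<Rightarrow> (nat \<Rightarrow> nat \<Rightarrow> real \<Rightarrow> real \<Rightarrow> real) \<Rightarrow> real \<Rightarrow> real \<Rightarrow> real" where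
  "approx_prob N T r lo hi =
     (let ymin = (\<lambda>i. node_min T (r i)); ymax = (\<lambda>i. node_max T (r i))
      in 1 / (4 * real N) *
         (\<Sum>i=1..N. (erf (phi N ymin i hi) - erf (phi N ymin i lo)) *
                    (erf (phi N ymax i hi) - erf (phi N ymax i lo))))"

definition constraint_fun ::
  "nat \<Rightarrow> real \<Rightarrow> (nat \<Rightarrow> nat \<Rightarrow> real \<Rightarrow> real \<Rightarrow> real) \<Rightarrow> real \<Rightarrow> real \<Rightarrow> real \<Rightarrow> real" where
  "constraint_fun N T r lo \<alpha> hi = \<alpha> - approx_prob N T r lo hi"

(* Every global minimizer over S is in particular a local one. *)
definition local_minimizer :: "(real \<Rightarrow> real) \<Rightarrow> real set \<Rightarrow> real \<Rightarrow> bool" where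
  "local_minimizer f S x \<longleftrightarrow> x \<in> S \<and> (\<exists>\<epsilon>>0. \<forall>y\<in>S. \<bar>y - x\<bar> < \<epsilon> \<longrightarrow> f x \<le> f y)"

lemma transport_solution_classical:
  assumes "\<And>t x. t \<in> {0..T} \<Longrightarrow> x \<in> {0..L} \<Longrightarrow>
    \<exists>rt rx. ((\<lambda>(t, x). r t x) has_derivative (\<lambda>(u, v). rt * u + rx * v))
              (at (t, x) within {0..T} \<times> {0..L}) \<and>
            rt + d * rx = m * r t x"
  shows "transport_solution T L d m r"
  unfolding transport_solution_def
proof (intro ballI)
  fix t x assume tx: "t \<in> {0..T}" "x \<in> {0..L}"
  let ?S = "{s. t + s \<in> {0..T} \<and> x + d * s \<in> {0..L}}"
  let ?c = "\<lambda>s. (t + s, x + d * s)"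
  obtain rt rx where
    D: "((\<lambda>(t, x). r t x) has_derivative (\<lambda>(u, v). rt * u + rx * v))
          (at (t, x) within {0..T} \<times> {0..L})"
    and eq: "rt + d * rx = m * r t x"
    using assms[OF tx] by blast
  have c: "(?c has_derivative (\<lambda>h. (h, d * h))) (at 0 within ?S)"
    by (auto intro!: derivative_eq_intros)
  have "((\<lambda>(t, x). r t x) has_derivative (\<lambda>(u, v). rt * u + rx * v)) (at (?c 0) within ?c ` ?S)"
    using has_derivative_subset[OF D, of "?c ` ?S"] by (simp add: image_subset_iff)
  from diff_chain_within[OF c this]
  have "((\<lambda>s. r (t + s) (x + d * s)) has_derivative (\<lambda>h. rt * h + rx * (d * h))) (at 0 within ?S)"
    by (simp add: o_def)
  moreover have "(\<lambda>h. rt * h + rx * (d * h)) = (*) (m * r t x)"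
    unfolding eq[symmetric] by (auto simp: algebra_simps)
  ultimately show "((\<lambda>s. r (t + s) (x + d * s)) has_real_derivative m * r t x) (at 0 within ?S)"
    by (simp add: has_field_derivative_def)
qed

lemma transport_solution_backward:
  assumes sol: "transport_solution T L d m r" and tx: "t \<in> {0..T}" "x \<in> {0..L}"
    and "\<tau> \<ge> 0" "t - \<tau> \<in> {0..T}" "x - d * \<tau> \<in> {0..L}" "d < 0"
  shows "r t x = exp (m * \<tau>) * r (t - \<tau>) (x - d * \<tau>)"
proof -
  define h where "h s = exp (- m * s) * r (t + s) (x + d * s)" for s
  have inr: "t + s \<in> {0..T} \<and> x + d * s \<in> {0..L}" if "s \<in> {-\<tau>..0}" for s
  proof -
    have "d * s \<le> d * - \<tau>" "0 \<le> d * s"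
      using that \<open>d < 0\<close> mult_left_mono_neg[of "- \<tau>" s d] mult_nonpos_nonpos[of d s] by auto
    then show ?thesis using that assms by auto
  qed
  have "(h has_real_derivative 0) (at s within {-\<tau>..0})" if s: "s \<in> {-\<tau>..0}" for s
  proof -
    let ?q = "\<lambda>u. r (t + s + u) (x + d * s + d * u)"
    have "(?q has_real_derivative m * r (t + s) (x + d * s))
            (at 0 within {u. t + s + u \<in> {0..T} \<and> x + d * s + d * u \<in> {0..L}})"
      using sol inr[OF s] unfolding transport_solution_def by blast
    then have "(?q has_real_derivative m * r (t + s) (x + d * s))
            (at 0 within (\<lambda>u. u - s) ` {-\<tau>..0})"
    proof (rule DERIV_subset, intro subsetI CollectI)
      fix u assume "u \<in> (\<lambda>u. u - s) ` {-\<tau>..0}"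
      then have "s + u \<in> {-\<tau>..0}" by auto
      from inr[OF this] show "t + s + u \<in> {0..T} \<and> x + d * s + d * u \<in> {0..L}"
        by (simp add: algebra_simps)
    qed
    then have "(?q has_real_derivative m * r (t + s) (x + d * s))
            (at (s - s) within (\<lambda>u. u - s) ` {-\<tau>..0})" by simp
    moreover have "((\<lambda>u. u - s) has_real_derivative 1) (at s within {-\<tau>..0})"
      by (auto intro!: derivative_eq_intros)
    ultimately have "(?q \<circ> (\<lambda>u. u - s) has_real_derivative m * r (t + s) (x + d * s) * 1)
            (at s within {-\<tau>..0})"
      by (rule DERIV_image_chain)
    then have q: "((\<lambda>u. r (t + u) (x + d * u)) has_real_derivative m * r (t + s) (x + d * s))
            (at s within {-\<tau>..0})"
      by (simp add: o_def algebra_simps)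
    show ?thesis unfolding h_def
      by (rule derivative_eq_intros q refl | simp)+
  qed
  then have "\<exists>c. \<forall>s\<in>{-\<tau>..0}. h s = c"
    by (intro has_field_derivative_zero_constant) auto
  then have "h (-\<tau>) = h 0"
    using \<open>\<tau> \<ge> 0\<close> by auto
  then show ?thesis by (simp add: h_def)
qed

(* The data determine the state on the whole network. *)
lemma network_solution_unique:
  assumes r: "network_solution n T L d m r0 b r" and r': "network_solution n T L d m r0 b r'"
    and "\<And>k. k \<in> {1..n} \<Longrightarrow> L k > 0" "\<And>k. k \<in> {1..n} \<Longrightarrow> d k < 0"
    and "k \<in> {1..n}" "t \<in> {0..T}" "x \<in> {0..L k}"
  shows "r k t x = r' k t x"
  using assms(5-)
proof (induction "n - k" arbitrary: k t x rule: less_induct)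
  case less
  note k = \<open>k \<in> {1..n}\<close>
  have d: "d k < 0" using assms k by auto
  define \<tau> where "\<tau> = min t ((L k - x) / (- d k))"
  have 0: "\<tau> \<ge> 0" "\<tau> \<le> t" "- d k * \<tau> \<le> L k - x" "0 \<le> - d k * \<tau>"
    using d less.prems by (auto simp: \<tau>_def min_def field_simps mult_nonpos_nonneg)
  have m: "t - \<tau> \<in> {0..T}" "x - d k * \<tau> \<in> {0..L k}" using 0 less.prems by auto
  have "t - \<tau> = 0 \<or> x - d k * \<tau> = L k"
    using d by (auto simp: \<tau>_def min_def)
  moreover have "r k 0 y = r' k 0 y" if "y \<in> {0..L k}" for y
    using r r' k that unfolding network_solution_def by metis
  moreover have "r k s (L k) = r' k s (L k)" if s: "s \<in> {0..T}" for s
  proof (cases "k = n")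
    case True
    then show ?thesis using r r' k s unfolding network_solution_def by metis
  next
    case False
    then have "r (k + 1) s 0 = r' (k + 1) s 0"
      using k s assms(3)[of "k + 1"] by (intro less.hyps) auto
    then show ?thesis using r r' k s unfolding network_solution_def by metis
  qed
  ultimately have "r k (t - \<tau>) (x - d k * \<tau>) = r' k (t - \<tau>) (x - d k * \<tau>)"
    using m by metis
  moreover have "transport_solution T (L k) (d k) (m k) (r k)"
      "transport_solution T (L k) (d k) (m k) (r' k)"
    using r r' k unfolding network_solution_def by blast+
  ultimately show ?case
    using transport_solution_backward[of T "L k" "d k" "m k" "r k" t x \<tau>]
      transport_solution_backward[of T "L k" "d k" "m k" "r' k" t x \<tau>] d 0 m less.prems by metis
qed

lemma erf_has_real_derivative:
  "(erf has_real_derivative 2 / sqrt pi * exp (- x\<^sup>2)) (at x)"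
proof -
  have "((\<lambda>u. LBINT t=0..u. exp (- t\<^sup>2)) has_vector_derivative exp (- x\<^sup>2))
          (at x within {-\<bar>x\<bar> - 1..\<bar>x\<bar> + 1})"
    unfolding zero_ereal_def
    by (rule interval_integral_FTC2) (auto intro!: continuous_intros)
  moreover have "at x within {-\<bar>x\<bar> - 1..\<bar>x\<bar> + 1} = at x"
    by (rule at_within_interior) (simp, linarith)
  ultimately have "((\<lambda>u. LBINT t=0..u. exp (- t\<^sup>2)) has_real_derivative exp (- x\<^sup>2)) (at x)"
    by (simp add: has_real_derivative_iff_has_vector_derivative)
  then show ?thesis
    unfolding erf_def[abs_def] by (rule DERIV_cmult)
qed

lemma constraint_fun_differentiable: "constraint_fun N T r lo \<alpha> differentiable (at x)"
proof -
  have "(\<lambda>x. erf (phi N y i x)) differentiable (at x)" for y i x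
  proof -
    define c where "c = sqrt 2 * bandwidth N * sqrt (sample_variance N y)"
    have "((\<lambda>x. (x - y i) / c) has_real_derivative 1 / c) (at x)"
      by (cases "c = 0") (auto intro!: derivative_eq_intros)
    from DERIV_chain2[OF erf_has_real_derivative this] show ?thesis
      unfolding phi_def c_def real_differentiable_def by blast
  qed
  then show ?thesis
    unfolding constraint_fun_def[abs_def] approx_prob_def Let_def
    by (intro differentiable_diff differentiable_mult differentiable_const differentiable_sum) auto
qed

end

theory Submission
  imports Defs
begin

text \<open>Since P_N vanishes at r0_min and the constraint demands at least \<alpha> > 0, the minimizer lies in
  the interior of [r0_min, \<infinity>). There P_N is a sum of products of positive strictly increasing
  functions, so its derivative is positive and the gradient of the constraint cannot vanish, which
  is the constraint qualification.\<close>

lemma erf_strict_mono: "x < y \<Longrightarrow> erf x < erf y"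
proof (erule DERIV_pos_imp_increasing)
  show "\<exists>D. (erf has_real_derivative D) (at u) \<and> D > 0" for u
    using erf_has_real_derivative[of u] by (intro exI conjI) auto
qed

lemma bandwidth_pos: "N > 0 \<Longrightarrow> bandwidth N > 0"
  by (simp add: bandwidth_def)

lemma phi_strict_mono:
  assumes "N > 0" "sample_variance N y > 0" "x < z"
  shows "phi N y i x < phi N y i z"
  using assms bandwidth_pos[of N] by (simp add: phi_def divide_strict_right_mono)

text \<open>Positive variance makes the scale \<open>c\<close> in \<open>phi\<close> positive, so
  the chain rule gives a Gaussian times \<open>1 / c\<close>. For \<open>c = 0\<close>, division by
  zero would make \<open>phi\<close> constant and the derivative zero.\<close>

lemma erf_phi_has_pos_derivative:
  assumes "N > 0" "sample_variance N y > 0"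
  shows "\<exists>D>0. ((\<lambda>x. erf (phi N y i x)) has_real_derivative D) (at x)"
proof -
  define c where "c = sqrt 2 * bandwidth N * sqrt (sample_variance N y)"
  have "c > 0" using assms bandwidth_pos[of N] by (simp add: c_def)
  have "(phi N y i has_real_derivative 1 / c) (at x)"
    unfolding phi_def[abs_def] c_def[symmetric] using \<open>c > 0\<close>
    by (auto intro!: derivative_eq_intros)
  from DERIV_chain2[OF erf_has_real_derivative this] show ?thesis
    using \<open>c > 0\<close> by (intro exI[of _ "2 / sqrt pi * exp (- (phi N y i x)\<^sup>2) * (1 / c)"]) simp
qed

lemma deriv_constraint_fun_neg:
  assumes "N > 0" "lo < x"
    and "sample_variance N (\<lambda>i. node_min T (r i)) > 0"
    and "sample_variance N (\<lambda>i. node_max T (r i)) > 0"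
  shows "deriv (constraint_fun N T r lo \<alpha>) x < 0"
proof -
  let ?A = "\<lambda>i z. erf (phi N (\<lambda>i. node_min T (r i)) i z)"
  let ?B = "\<lambda>i z. erf (phi N (\<lambda>i. node_max T (r i)) i z)"
  have "\<forall>i. \<exists>D. D > 0 \<and> (?A i has_real_derivative D) (at x)"
    using erf_phi_has_pos_derivative[OF assms(1,3)] by blast
  from choice[OF this] obtain A'
    where A': "\<And>i. A' i > 0" "\<And>i. (?A i has_real_derivative A' i) (at x)" by blast
  have "\<forall>i. \<exists>D. D > 0 \<and> (?B i has_real_derivative D) (at x)"
    using erf_phi_has_pos_derivative[OF assms(1,4)] by blast
  from choice[OF this] obtain B'
    where B': "\<And>i. B' i > 0" "\<And>i. (?B i has_real_derivative B' i) (at x)" by blast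
  \<comment> \<open>The product rule, applied summand by summand: the factors are the increments of
    \<open>?A i\<close> and \<open>?B i\<close> from \<open>lo\<close> to \<open>x\<close>, and
    their values at \<open>lo\<close> are constants.\<close>
  let ?S = "\<Sum>i=1..N. A' i * (?B i x - ?B i lo) + B' i * (?A i x - ?A i lo)"
  have "(constraint_fun N T r lo \<alpha> has_real_derivative 0 - 1 / (4 * real N) * ?S) (at x)"
    unfolding constraint_fun_def[abs_def] approx_prob_def Let_def
    by (intro DERIV_diff DERIV_const DERIV_cmult DERIV_sum)
      (auto intro!: derivative_eq_intros A' B')
  \<comment> \<open>Both increments are positive because \<open>lo < x\<close>, and the index set is
    nonempty because \<open>N > 0\<close>; hence the sum is strictly positive.\<close>
  moreover have "?S > 0"
    using assms A'(1) B'(1)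
    by (intro sum_pos add_pos_pos mult_pos_pos) (auto intro!: erf_strict_mono phi_strict_mono)
  ultimately show ?thesis
    using \<open>N > 0\<close> by (simp add: DERIV_imp_deriv)
qed

text \<open>In one dimension, a negative slope of \<open>g\<close> makes small steps to the right
  feasible when the constraint is active. When it is inactive, \<open>x\<close> is an unconstrained
  local minimizer because \<open>a < x\<close>.\<close>

lemma local_minimizer_imp_KKT:
  fixes f g :: "real \<Rightarrow> real"
  assumes min: "local_minimizer f {y \<in> {a..}. g y \<le> 0} x"
    and "a < x" "f differentiable (at x)" "g differentiable (at x)" "deriv g x < 0"
  shows "\<exists>\<mu>\<ge>0. deriv f x + \<mu> * deriv g x = 0 \<and> g x \<le> 0 \<and> \<mu> * g x = 0"
proof -
  have f': "(f has_real_derivative deriv f x) (at x)" and g': "(g has_real_derivative deriv g x) (at x)"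
    using assms by (simp_all add: DERIV_deriv_iff_real_differentiable)
  obtain \<epsilon> where "\<epsilon> > 0" and feas: "g x \<le> 0"
    and \<epsilon>: "\<And>y. y \<ge> a \<Longrightarrow> g y \<le> 0 \<Longrightarrow> \<bar>y - x\<bar> < \<epsilon> \<Longrightarrow> f x \<le> f y"
    using min unfolding local_minimizer_def by auto
  show ?thesis
  proof (cases "g x = 0")
    case True
    obtain \<delta> where \<delta>: "\<delta> > 0" "\<And>h. h > 0 \<Longrightarrow> h < \<delta> \<Longrightarrow> g (x + h) < g x"
      using DERIV_neg_dec_right[OF g' \<open>deriv g x < 0\<close>] by blast
    \<comment> \<open>Points slightly to the right of \<open>x\<close> stay above \<open>a\<close>
      and satisfy \<open>g < 0\<close>, so \<open>f\<close> cannot decrease in that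
      direction.\<close>
    have "deriv f x \<ge> 0"
    proof (rule ccontr)
      assume "\<not> deriv f x \<ge> 0"
      then obtain \<eta> where \<eta>: "\<eta> > 0" "\<And>h. h > 0 \<Longrightarrow> h < \<eta> \<Longrightarrow> f (x + h) < f x"
        using DERIV_neg_dec_right[OF f'] by (meson not_le)
      \<comment> \<open>Halving puts \<open>h\<close> strictly below all three radii:
        \<open>x + h\<close> is feasible, lies in the range of minimality, and yet has a smaller
        value of \<open>f\<close>.\<close>
      define h where "h = min (min \<delta> \<eta>) \<epsilon> / 2"
      have "h > 0" "h < \<delta>" "h < \<eta>" "h < \<epsilon>"
        using \<delta>(1) \<eta>(1) \<open>\<epsilon> > 0\<close> by (auto simp: h_def min_def)
      with \<delta>(2)[of h] \<eta>(2)[of h] \<epsilon>[of "x + h"] True \<open>a < x\<close> show False by simp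
    qed
    then show ?thesis
      \<comment> \<open>Stationarity determines the multiplier; it is nonnegative because the slopes
        of \<open>f\<close> and \<open>g\<close> have opposite signs or that of \<open>f\<close> is
        zero.\<close>
      using True \<open>deriv g x < 0\<close>
      by (intro exI[of _ "- deriv f x / deriv g x"]) (simp add: divide_nonneg_neg)
  next
    case False
    \<comment> \<open>By continuity the strict inequality persists near \<open>x\<close>, so a full
      neighbourhood is feasible. Fermat's rule then gives a zero derivative of \<open>f\<close>, and
      the multiplier is 0.\<close>
    have "\<forall>\<^sub>F y in nhds x. g y < 0"
      using DERIV_isCont[OF g'] False feas
      by (intro order_tendstoD(2)[where y = "g x"]) (auto simp: isCont_def tendsto_at_iff_tendsto_nhds)
    then have "\<forall>\<^sub>F y in nhds x. g y < 0 \<and> a < y \<and> \<bar>y - x\<bar> < \<epsilon>"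
      using eventually_nhds_in_open[of "{a<..}" x] \<open>a < x\<close>
        eventually_nhds_metric[of "\<lambda>y. \<bar>y - x\<bar> < \<epsilon>" x] \<open>\<epsilon> > 0\<close>
      by (intro eventually_conj) (auto simp: dist_real_def)
    then obtain \<delta> where "\<delta> > 0" "\<And>y. \<bar>x - y\<bar> < \<delta> \<Longrightarrow> f x \<le> f y"
      unfolding eventually_nhds_metric dist_real_def using \<epsilon> by (metis abs_minus_commute less_imp_le)
    then have "deriv f x = 0"
      using DERIV_local_min[OF f'] by blast
    then show ?thesis using feas by auto
  qed
qed

theorem corollary16:
  fixes n N :: nat and T \<alpha> r0_min r0_max_opt :: real
    and L d m :: "nat \<Rightarrow> real"
    and r0 :: "nat \<Rightarrow> real \<Rightarrow> real"
    and b :: "nat \<Rightarrow> nat \<Rightarrow> real \<Rightarrow> real"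
    and r :: "nat \<Rightarrow> nat \<Rightarrow> real \<Rightarrow> real \<Rightarrow> real"
    and f :: "real \<Rightarrow> real"
  assumes "n \<ge> 1" and "T > 0"
    and "\<And>k. k \<in> {1..n} \<Longrightarrow> L k > 0"
    and "\<And>k. k \<in> {1..n} \<Longrightarrow> d k < 0"
    and "\<And>k. k \<in> {1..n} \<Longrightarrow> m k \<le> 0"
    and "N > 1"
    and "\<And>i k t. i \<in> {1..N} \<Longrightarrow> k \<in> {1..n} \<Longrightarrow> t \<in> {0..T} \<Longrightarrow> b i k t \<ge> 0"
    and "\<And>i. i \<in> {1..N} \<Longrightarrow> network_solution n T L d m r0 (b i) (r i)"
    and "\<And>i. i \<in> {1..N} \<Longrightarrow>
           \<exists>t\<in>{0..T}. \<forall>s\<in>{0..T}. node_value (r i) t \<le> node_value (r i) s"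
    and "\<And>i. i \<in> {1..N} \<Longrightarrow>
           \<exists>t\<in>{0..T}. \<forall>s\<in>{0..T}. node_value (r i) s \<le> node_value (r i) t"
    and "sample_variance N (\<lambda>i. node_min T (r i)) > 0"
    and "sample_variance N (\<lambda>i. node_max T (r i)) > 0"
    and "0 < \<alpha>" and "\<alpha> < 1"
    and "\<And>x. f differentiable (at x)"
    and "local_minimizer f {x \<in> {r0_min..}. approx_prob N T r r0_min x \<ge> \<alpha>} r0_max_opt"
  shows "\<exists>\<mu>\<ge>0.
           deriv f r0_max_opt + \<mu> * deriv (constraint_fun N T r r0_min \<alpha>) r0_max_opt = 0 \<and>
           constraint_fun N T r r0_min \<alpha> r0_max_opt \<le> 0 \<and>
           \<mu> * constraint_fun N T r r0_min \<alpha> r0_max_opt = 0"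
proof -
  let ?g = "constraint_fun N T r r0_min \<alpha>"
  have min: "local_minimizer f {x \<in> {r0_min..}. ?g x \<le> 0} r0_max_opt"
    using assms(16) by (simp add: constraint_fun_def)
  \<comment> \<open>Each factor is a difference of two equal values here, so \<open>r0_min\<close>
    violates the constraint and cannot be the minimizer.\<close>
  have "approx_prob N T r r0_min r0_min = 0"
    by (simp add: approx_prob_def)
  then have "r0_min < r0_max_opt"
    using assms(13,16) by (force simp: local_minimizer_def less_le)
  then show ?thesis
    using assms(6,11,12,15)
    by (intro local_minimizer_imp_KKT[OF min] constraint_fun_differentiable deriv_constraint_fun_neg)
      auto
qed

end
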